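(* Let $G$ be a finite connected nonbipartite regular graph (loops and multiple edges allowed) with vertex set $V$ and vertex degree $d(v)=q+1\ge 3$ for all $v\in V$. There is a constant $C_G>0$ depending only on $G$ such that for every function $f:V\to\mathbb{R}$ there is a number $\beta_{\max}\in[q^{-1/2},1)$ such that both of the following hold with these same constants: (i) for every directed edge $a$ in $G$ and every integer $r\ge 0$, $\big|M_{r,a}(f)-\frac{1}{|V|}\sum_{v\in V}f(v)\big|\le C_G\|f\|_2\beta_{\max}^{\,r}$; (ii) for every (nonempty) finite connected subgraph $X$ of the universal covering tree $\widetilde G$ and every integer $r\ge 0$, $$\Big|\frac{1}{|\mathcal{T}_r(X)|}\sum_{v\in\mathcal{T}_r(X)}\tilde f(v)-\frac{1}{|V|}\sum_{v\in V}f(v)\Big|\le C_G\,\|f\|_2\,\beta_{\max}^{\,r}.$$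
   Context: A loop at a vertex contributes $2$ to its degree. The norm is $\|f\|_2=\langle f,f\rangle^{1/2}$ with $\langle f,g\rangle=\sum_{v\in V}f(v)g(v)$. Universal cover: $\widetilde G$ is the universal covering tree of $G$, with vertex set $\widetilde V$: fix a root vertex of $G$; the vertices of $\widetilde G$ are the non-backtracking paths in $G$ starting at the root, two being adjacent if they differ by exactly one edge at the end. The projection $\pi:\widetilde G\to G$ sends a path to its end vertex. The lift of $f$ is $\tilde f=f\circ\pi$. $\delta$ is the combinatorial distance. Spheres and arcs: for $v_0\in\widetilde V$, $S_r(v_0)=\{v\in\widetilde V:\delta(v,v_0)=r\}$. For a directed edge $a$ of $\widetilde G$ from $w'$ to $w$, $A_0(a)=\{w'\}$ and $A_{r+1}(a)=S_{r+1}(w')\cap S_r(w)$ for $r\ge 0$, and $M_{r,a}(f)=\frac{1}{|A_r(a)|}\sum_{x\in A_r(a)}\tilde f(x)$. For a directed edge $a$ of $G$, $M_{r,a}(f)$ is computed using any lift of $a$ to $\widetilde G$ (the value does not depend on the lift). Tubes: for a finite connected subgraph $X$ of $\widetilde G$ with vertex set $V(X)$, the vertex tube of radius $r$ around $X$ is $\mathcal{T}_r(X)=\{v\in\widetilde V:\min_{x\in V(X)}\delta(v,x)=r\}$. The constant $C_G$ does not depend on $a$, $X$, $f$, $r$; the rate $\beta_{\max}$ may depend on $G$ and $f$ but not on $a$, $X$ or $r$. *)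

theory Defs
  imports "HOL-Analysis.Analysis" "Graph_Theory.Graph_Theory"
begin

text \<open>
  An undirected multigraph is a \<^locale>\<open>bidirected_digraph\<close>: every edge is a pair of mutually
  inverse arcs, exchanged by the fixed-point-free involution \<open>rv\<close>. The arcs are the directed
  edges of the graph. An undirected loop consists of two distinct arcs with the same end vertices,
  so it adds 2 to \<^const>\<open>out_degree\<close>, which is therefore the degree of the undirected graph.
\<close>

definition bipartite :: "('a, 'b) pre_digraph \<Rightarrow> bool" where
  "bipartite G \<longleftrightarrow> (\<exists>A B. verts G = A \<union> B \<and> A \<inter> B = {} \<and>
     (\<forall>e\<in>arcs G. (tail G e \<in> A \<and> head G e \<in> B) \<or> (tail G e \<in> B \<and> head G e \<in> A)))"

definition graph_dist :: "('a, 'b) pre_digraph \<Rightarrow> 'a \<Rightarrow> 'a \<Rightarrow> nat" where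
  "graph_dist H u v = (LEAST n. \<exists>p. pre_digraph.awalk H u p v \<and> length p = n)"

definition graph_sphere :: "('a, 'b) pre_digraph \<Rightarrow> 'a \<Rightarrow> nat \<Rightarrow> 'a set" where
  "graph_sphere H v0 r = {v \<in> verts H. graph_dist H v v0 = r}"

fun arc_sphere :: "('a, 'b) pre_digraph \<Rightarrow> 'b \<Rightarrow> nat \<Rightarrow> 'a set" where
  "arc_sphere H a 0 = {tail H a}"
| "arc_sphere H a (Suc r) =
     graph_sphere H (tail H a) (Suc r) \<inter> graph_sphere H (head H a) r"

text \<open>Only meant for nonempty finite \<open>X\<close>.\<close>

definition vertex_tube :: "('a, 'b) pre_digraph \<Rightarrow> ('a, 'b) pre_digraph \<Rightarrow> nat \<Rightarrow> 'a set" where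
  "vertex_tube H X r = {v \<in> verts H. Min (graph_dist H v ` verts X) = r}"

definition average :: "('a \<Rightarrow> real) \<Rightarrow> 'a set \<Rightarrow> real" where
  "average g A = (\<Sum>x\<in>A. g x) / real (card A)"

text \<open>
  Paths are lists of arcs, so that parallel edges and the two directions of a loop are told apart.
\<close>

definition nonbacktracking_walks ::
    "('a, 'b) pre_digraph \<Rightarrow> ('b \<Rightarrow> 'b) \<Rightarrow> 'a \<Rightarrow> 'b list set" where
  "nonbacktracking_walks G rv base =
     {p. (\<exists>v. pre_digraph.awalk G base p v) \<and> successively (\<lambda>e e'. e' \<noteq> rv e) p}"

definition universal_cover ::
    "('a, 'b) pre_digraph \<Rightarrow> ('b \<Rightarrow> 'b) \<Rightarrow> 'a \<Rightarrow> ('b list, 'b list \<times> 'b list) pre_digraph" where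
  "universal_cover G rv base = with_proj
     \<lparr> pverts = nonbacktracking_walks G rv base,
       parcs = {(p, p'). p \<in> nonbacktracking_walks G rv base \<and>
                         p' \<in> nonbacktracking_walks G rv base \<and>
                         (\<exists>e. p' = p @ [e] \<or> p = p' @ [e])} \<rparr>"

definition cover_proj :: "('a, 'b) pre_digraph \<Rightarrow> 'a \<Rightarrow> 'b list \<Rightarrow> 'a" where
  "cover_proj G base p = pre_digraph.awlast G base p"

text \<open>
  The arc from \<open>p\<close> to \<open>p @ [e]\<close> lies above \<open>e\<close>, the opposite arc above the inverse of \<open>e\<close>.
\<close>

definition cover_proj_arc :: "('b \<Rightarrow> 'b) \<Rightarrow> 'b list \<times> 'b list \<Rightarrow> 'b" where
  "cover_proj_arc rv = (\<lambda>(p, p'). if length p < length p' then last p' else rv (last p))"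

definition arc_lifts ::
    "('a, 'b) pre_digraph \<Rightarrow> ('b \<Rightarrow> 'b) \<Rightarrow> 'a \<Rightarrow> 'b \<Rightarrow> ('b list \<times> 'b list) set" where
  "arc_lifts G rv base a = {l \<in> arcs (universal_cover G rv base). cover_proj_arc rv l = a}"

definition lift_fun :: "('a, 'b) pre_digraph \<Rightarrow> 'a \<Rightarrow> ('a \<Rightarrow> real) \<Rightarrow> 'b list \<Rightarrow> real" where
  "lift_fun G base f = f \<circ> cover_proj G base"

text \<open>Here \<open>l\<close> is an arc of the universal cover.\<close>

definition arc_mean ::
    "('a, 'b) pre_digraph \<Rightarrow> ('b \<Rightarrow> 'b) \<Rightarrow> 'a \<Rightarrow> nat \<Rightarrow> 'b list \<times> 'b list \<Rightarrow> ('a \<Rightarrow> real) \<Rightarrow> real" where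
  "arc_mean G rv base r l f =
     average (lift_fun G base f) (arc_sphere (universal_cover G rv base) l r)"

definition tube_mean ::
    "('a, 'b) pre_digraph \<Rightarrow> ('b \<Rightarrow> 'b) \<Rightarrow> 'a \<Rightarrow> nat \<Rightarrow>
     ('b list, 'b list \<times> 'b list) pre_digraph \<Rightarrow> ('a \<Rightarrow> real) \<Rightarrow> real" where
  "tube_mean G rv base r X f =
     average (lift_fun G base f) (vertex_tube (universal_cover G rv base) X r)"

end

theory Submission
  imports Defs "HOL-Library.Sublist"
begin

text \<open>
  The arc averages of \<open>f\<close> are the iterates of one averaging operator on the arcs of \<open>G\<close>. Let \<open>T g a\<close>
  be the mean of \<open>g\<close> over the \<open>q\<close> arcs that may follow \<open>a\<close> in a nonbacktracking walk. In a tree the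
  set of vertices behind an arc, at given distance, splits into the sets behind the \<open>q\<close> arcs that
  follow it (\<open>arc_sphere_Suc_Suc\<close>). As the cover looks locally like \<open>G\<close>, the average of the
  lift of \<open>f\<close> over an arc sphere of radius \<open>r + 1\<close> is \<open>(T ^^ r) (f \<circ> head)\<close> at the arc below
  (\<open>average_arc_sphere\<close>).

  Each arc follows exactly \<open>q\<close> arcs, so \<open>T\<close> is doubly stochastic: it preserves sums and
  contracts the Euclidean norm, the loss being a sum of variances (\<open>nb_avg_energy\<close>). If neither of
  the steps from \<open>g\<close> to \<open>T g\<close> and from \<open>T g\<close> to \<open>T (T g)\<close> loses norm, both functions are constant on
  continuation sets. Since every vertex has at least three outgoing arcs, two of them always
  continue a common arc, so both functions depend only on the tail, and along an edge their values
  are exchanged. On a connected graph this leaves at most two values of \<open>g\<close>; if there are two, they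
  form a bipartition, and otherwise \<open>g\<close> is constant (\<open>rigidity\<close>). Hence \<open>T\<close> applied twice strictly
  decreases the norm of every nonzero function of sum zero, and by compactness of the unit sphere
  it does so by a uniform factor below 1 (\<open>uniform_contraction\<close>). Iteration gives exponential
  decay with a rate and a constant that depend on \<open>G\<close> only: one rate serves for all \<open>f\<close>.

  For tubes, a vertex \<open>v\<close> outside a connected subgraph \<open>X\<close> of a tree sees all of \<open>X\<close> through one arc
  that leaves \<open>X\<close> (\<open>gate\<close>). So a tube of positive radius is the disjoint union of the arc spheres of
  that radius behind the arcs that leave \<open>X\<close> (\<open>vertex_tube_Suc\<close>), and an average over it is a
  weighted mean of arc averages. Radius zero is covered by the trivial bound, as the constant is at
  least 1.
\<close>

section \<open>Averages and connected graphs\<close>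

lemma average_const:
  assumes "finite A" "A \<noteq> {}" "\<And>x. x \<in> A \<Longrightarrow> g x = c"
  shows "average g A = c"
  using assms by (simp add: average_def)

lemma average_diff_const:
  assumes "finite A" "A \<noteq> {}"
  shows "average (\<lambda>x. g x - c) A = average g A - c"
  using assms by (simp add: average_def sum_subtractf diff_divide_distrib)

lemma sum_eq_card_average:
  assumes "finite A"
  shows "(\<Sum>x\<in>A. g x) = real (card A) * average g A"
  using assms by (cases "A = {}") (auto simp: average_def)

lemma sum_square_deviation:
  assumes "finite A"
  shows "(\<Sum>x\<in>A. (g x - average g A)\<^sup>2) = (\<Sum>x\<in>A. (g x)\<^sup>2) - real (card A) * (average g A)\<^sup>2"
proof -
  let ?m = "average g A"
  have "(\<Sum>x\<in>A. (g x - ?m)\<^sup>2) = (\<Sum>x\<in>A. (g x)\<^sup>2 - 2 * ?m * g x + ?m\<^sup>2)"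
    by (simp add: power2_diff algebra_simps)
  also have "\<dots> = (\<Sum>x\<in>A. (g x)\<^sup>2) - 2 * ?m * (\<Sum>x\<in>A. g x) + real (card A) * ?m\<^sup>2"
    by (simp add: sum.distrib sum_subtractf sum_distrib_left)
  finally show ?thesis
    by (simp add: sum_eq_card_average[OF assms] power2_eq_square algebra_simps)
qed

lemma abs_le_L2_set:
  assumes "finite A" "x \<in> A"
  shows "\<bar>g x\<bar> \<le> L2_set g A"
  using member_le_L2_set[OF assms, of "\<lambda>x. \<bar>g x\<bar>"] by (simp add: L2_set_def)

lemma L2_set_deviation_le:
  assumes "finite A"
  shows "L2_set (\<lambda>x. g x - average g A) A \<le> L2_set g A"
  unfolding L2_set_def sum_square_deviation[OF assms] by (simp)

lemma average_near_const:
  assumes "finite A" "A \<noteq> {}" "\<And>x. x \<in> A \<Longrightarrow> \<bar>g x - c\<bar> \<le> b"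
  shows "\<bar>average g A - c\<bar> \<le> b"
proof -
  have pos: "0 < real (card A)"
    using assms by (simp add: card_gt_0_iff)
  have "\<bar>\<Sum>x\<in>A. g x - c\<bar> \<le> (\<Sum>x\<in>A. b)"
    by (rule order_trans[OF sum_abs sum_mono]) (rule assms(3))
  then have "\<bar>\<Sum>x\<in>A. g x - c\<bar> \<le> real (card A) * b"
    by simp
  moreover have "average g A - c = (\<Sum>x\<in>A. g x - c) / real (card A)"
    using average_diff_const[OF assms(1,2), of g c] by (simp add: average_def)
  ultimately show ?thesis
    using pos by (simp add: divide_le_eq mult.commute)
qed

text \<open>
  The average over a disjoint union is a convex combination of the averages over the parts, with
  weights proportional to their sizes.
\<close>

lemma average_disjoint_Union_near_const:
  assumes "finite I" "I \<noteq> {}"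
    and "\<And>i. i \<in> I \<Longrightarrow> finite (A i)" "\<And>i. i \<in> I \<Longrightarrow> A i \<noteq> {}"
    and "\<And>i j. i \<in> I \<Longrightarrow> j \<in> I \<Longrightarrow> i \<noteq> j \<Longrightarrow> A i \<inter> A j = {}"
    and "\<And>i. i \<in> I \<Longrightarrow> \<bar>average g (A i) - c\<bar> \<le> b"
  shows "\<bar>average g (\<Union>i\<in>I. A i) - c\<bar> \<le> b"
proof -
  let ?U = "\<Union>i\<in>I. A i"
  have fin: "finite ?U" and ne: "?U \<noteq> {}"
    using assms(1-4) by auto
  then have pos: "0 < real (card ?U)"
    by (simp add: card_gt_0_iff)
  have "(\<Sum>x\<in>?U. g x - c) = (\<Sum>i\<in>I. \<Sum>x\<in>A i. g x - c)"
    using assms by (intro sum.UNION_disjoint) auto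
  also have "\<dots> = (\<Sum>i\<in>I. real (card (A i)) * (average g (A i) - c))"
    using assms by (intro sum.cong refl) (simp add: sum_eq_card_average average_diff_const)
  finally have "\<bar>\<Sum>x\<in>?U. g x - c\<bar> = \<bar>\<Sum>i\<in>I. real (card (A i)) * (average g (A i) - c)\<bar>"
    by simp
  also have "\<dots> \<le> (\<Sum>i\<in>I. real (card (A i)) * b)"
    using assms(6) by (intro order_trans[OF sum_abs sum_mono]) (auto simp: abs_mult intro: mult_left_mono)
  also have "\<dots> = real (\<Sum>i\<in>I. card (A i)) * b"
    by (simp add: sum_distrib_right)
  also have "(\<Sum>i\<in>I. card (A i)) = card ?U"
    using assms by (intro card_UN_disjoint[symmetric]) auto
  finally have "\<bar>\<Sum>x\<in>?U. g x - c\<bar> \<le> real (card ?U) * b" .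
  moreover have "average g ?U - c = (\<Sum>x\<in>?U. g x - c) / real (card ?U)"
    using average_diff_const[OF fin ne, of g c] by (simp add: average_def)
  ultimately show ?thesis
    using pos by (simp add: divide_le_eq mult.commute)
qed

text \<open>
  Connectedness of \<open>H\<close> refers to the symmetric closure of its arcs, hence the two directions.
\<close>

lemma connected_propagate:
  assumes "Digraph_Component.connected H" "x \<in> verts H" "z \<in> verts H" "P x"
    and fwd: "\<And>e. e \<in> arcs H \<Longrightarrow> P (tail H e) \<Longrightarrow> P (head H e)"
    and bwd: "\<And>e. e \<in> arcs H \<Longrightarrow> P (head H e) \<Longrightarrow> P (tail H e)"
  shows "P z"
proof -
  have "x \<rightarrow>\<^sup>*\<^bsub>with_proj (mk_symmetric H)\<^esub> z"
    using assms(1-3) by (auto simp: Digraph_Component.connected_def strongly_connected_def)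
  then have "(x, z) \<in> (parcs (mk_symmetric H))\<^sup>*"
    by (auto dest: reachable_rtranclI)
  then show ?thesis
    using \<open>P x\<close> by (induction rule: rtrancl_induct) (auto simp: parcs_mk_symmetric dest: fwd bwd)
qed

section \<open>The nonbacktracking averaging operator\<close>

definition continuations :: "('a, 'b) pre_digraph \<Rightarrow> ('b \<Rightarrow> 'b) \<Rightarrow> 'b \<Rightarrow> 'b set" where
  "continuations G rv a = out_arcs G (head G a) - {rv a}"

definition nb_avg :: "('a, 'b) pre_digraph \<Rightarrow> ('b \<Rightarrow> 'b) \<Rightarrow> ('b \<Rightarrow> real) \<Rightarrow> 'b \<Rightarrow> real" where
  "nb_avg G rv g a = average g (continuations G rv a)"

locale regular_graph = fin_digraph G + bidirected_digraph G rv
  for G :: "('a, 'b) pre_digraph" and rv :: "'b \<Rightarrow> 'b" +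
  fixes q :: nat
  assumes q_ge_2: "2 \<le> q"
    and regular: "v \<in> verts G \<Longrightarrow> out_degree G v = q + 1"
begin

abbreviation "cont \<equiv> continuations G rv"
abbreviation "T \<equiv> nb_avg G rv"

lemma card_out_arcs: "v \<in> verts G \<Longrightarrow> card (out_arcs G v) = q + 1"
  using regular by (simp add: out_degree_def)

lemma card_in_arcs: "v \<in> verts G \<Longrightarrow> card (in_arcs G v) = q + 1"
  by (simp add: in_arcs_eq card_image inj_on_arev card_out_arcs)

lemma finite_cont: "finite (cont a)"
  by (simp add: continuations_def finite_out_arcs)

lemma card_cont: "a \<in> arcs G \<Longrightarrow> card (cont a) = q"
  by (simp add: continuations_def card_Diff_singleton card_out_arcs)

lemma cont_nonempty: "a \<in> arcs G \<Longrightarrow> cont a \<noteq> {}"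
  using card_cont[of a] q_ge_2 by auto

lemma cont_subset: "cont a \<subseteq> arcs G"
  by (auto simp: continuations_def)

lemma nb_avg_cong: "(\<And>e. e \<in> arcs G \<Longrightarrow> g e = h e) \<Longrightarrow> T g a = T h a"
  using cont_subset[of a] by (auto simp: nb_avg_def average_def intro!: sum.cong)

text \<open>
  This is the column sum of a doubly stochastic matrix: an arc \<open>e\<close> continues exactly those arcs
  into its tail that differ from \<open>rv e\<close>, and there are \<open>q\<close> of them.
\<close>

lemma sum_sum_cont: "(\<Sum>a\<in>arcs G. \<Sum>e\<in>cont a. h e) = real q * (\<Sum>e\<in>arcs G. h e)"
proof -
  have "(\<Sum>a\<in>arcs G. \<Sum>e\<in>cont a. h e) = (\<Sum>a\<in>arcs G. \<Sum>e | e \<in> arcs G \<and> e \<in> cont a. h e)"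
    using cont_subset by (intro sum.cong refl) auto
  also have "\<dots> = (\<Sum>e\<in>arcs G. \<Sum>a | a \<in> arcs G \<and> e \<in> cont a. h e)"
    by (rule sum.swap_restrict) auto
  also have "\<dots> = (\<Sum>e\<in>arcs G. real q * h e)"
  proof (intro sum.cong refl)
    fix e assume e: "e \<in> arcs G"
    have "{a. a \<in> arcs G \<and> e \<in> cont a} = in_arcs G (tail G e) - {rv e}"
      using e by (auto simp: continuations_def)
    then show "(\<Sum>a | a \<in> arcs G \<and> e \<in> cont a. h e) = real q * h e"
      using e by (simp add: card_Diff_singleton card_in_arcs)
  qed
  finally show ?thesis
    by (simp add: sum_distrib_left)
qed

lemma sum_nb_avg: "(\<Sum>a\<in>arcs G. T g a) = (\<Sum>a\<in>arcs G. g a)"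
proof -
  have "(\<Sum>a\<in>arcs G. T g a) = (\<Sum>a\<in>arcs G. (\<Sum>e\<in>cont a. g e) / real q)"
    by (intro sum.cong refl) (simp add: nb_avg_def average_def card_cont)
  then show ?thesis
    using sum_sum_cont[of g] q_ge_2 by (simp flip: sum_divide_distrib)
qed

text \<open>
  For each arc \<open>a\<close>, the gap between the mean of the squares and the square of the mean over the
  continuations of \<open>a\<close> is a variance; in the sum over \<open>a\<close>, every square occurs \<open>q\<close> times.
\<close>

lemma nb_avg_energy:
  "real q * (\<Sum>a\<in>arcs G. (T g a)\<^sup>2)
    = real q * (\<Sum>a\<in>arcs G. (g a)\<^sup>2) - (\<Sum>a\<in>arcs G. \<Sum>e\<in>cont a. (g e - T g a)\<^sup>2)"
proof -
  have "(\<Sum>a\<in>arcs G. \<Sum>e\<in>cont a. (g e - T g a)\<^sup>2)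
      = (\<Sum>a\<in>arcs G. (\<Sum>e\<in>cont a. (g e)\<^sup>2) - real q * (T g a)\<^sup>2)"
    by (intro sum.cong refl) (simp add: nb_avg_def sum_square_deviation finite_cont card_cont)
  also have "\<dots> = real q * (\<Sum>a\<in>arcs G. (g a)\<^sup>2) - real q * (\<Sum>a\<in>arcs G. (T g a)\<^sup>2)"
    by (simp add: sum_subtractf sum_sum_cont sum_distrib_left)
  finally show ?thesis by simp
qed

lemma nb_avg_energy_le: "(\<Sum>a\<in>arcs G. (T g a)\<^sup>2) \<le> (\<Sum>a\<in>arcs G. (g a)\<^sup>2)"
proof -
  have "real q * (\<Sum>a\<in>arcs G. (T g a)\<^sup>2) \<le> real q * (\<Sum>a\<in>arcs G. (g a)\<^sup>2)"
    unfolding nb_avg_energy by (simp add: sum_nonneg)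
  then show ?thesis using q_ge_2 by simp
qed

lemma nb_avg_energy_eq_imp:
  assumes "(\<Sum>a\<in>arcs G. (T g a)\<^sup>2) = (\<Sum>a\<in>arcs G. (g a)\<^sup>2)" "a \<in> arcs G" "e \<in> cont a"
  shows "g e = T g a"
proof -
  have "(\<Sum>a\<in>arcs G. \<Sum>e\<in>cont a. (g e - T g a)\<^sup>2) = 0"
    using nb_avg_energy[of g] assms(1) by simp
  then have "(\<Sum>e\<in>cont a. (g e - T g a)\<^sup>2) = 0"
    using assms(2) by (subst (asm) sum_nonneg_eq_0_iff) (auto intro: sum_nonneg)
  then show ?thesis
    using assms(3) by (subst (asm) sum_nonneg_eq_0_iff) (auto simp: finite_cont)
qed

text \<open>
  At least three arcs leave the common tail. The reverse of a third one is continued by both \<open>e1\<close>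
  and \<open>e2\<close>.
\<close>

lemma constant_on_continuations_imp_tail:
  assumes g: "\<And>a e. a \<in> arcs G \<Longrightarrow> e \<in> cont a \<Longrightarrow> g e = k a"
    and e: "e1 \<in> arcs G" "e2 \<in> arcs G" "tail G e1 = tail G e2"
  shows "g e1 = g e2"
proof -
  have "card {e1, e2} \<le> 2"
    by (simp add: card_insert_if)
  then have "card {e1, e2} < card (out_arcs G (tail G e1))"
    using e q_ge_2 by (simp add: card_out_arcs)
  then have "\<not> out_arcs G (tail G e1) \<subseteq> {e1, e2}"
    by (meson card_mono finite.emptyI finite.insertI leD)
  then obtain e3 where "e3 \<in> arcs G" "tail G e3 = tail G e1" "e3 \<noteq> e1" "e3 \<noteq> e2"
    by (auto simp: subset_iff)
  then have "e1 \<in> cont (rv e3)" "e2 \<in> cont (rv e3)" "rv e3 \<in> arcs G"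
    using e by (auto simp: continuations_def)
  then show ?thesis
    using g by metis
qed

text \<open>
  By \<open>constant_on_continuations_imp_tail\<close>, \<open>g\<close> and \<open>T g\<close> are functions \<open>H\<close> and \<open>K\<close> of the tail. An arc and its reverse
  show that \<open>(H, K)\<close> at one end of an edge is \<open>(K, H)\<close> at the other end, so along walks the pair of
  values only gets swapped. If the two values differ, the level sets of \<open>H\<close> form a bipartition.
\<close>

lemma rigidity:
  assumes conn: "Digraph_Component.connected G" and nb: "\<not> bipartite G"
    and g: "\<And>a e. a \<in> arcs G \<Longrightarrow> e \<in> cont a \<Longrightarrow> g e = T g a"
    and Tg: "\<And>a e. a \<in> arcs G \<Longrightarrow> e \<in> cont a \<Longrightarrow> T g e = T (T g) a"
  shows "\<exists>c. \<forall>e\<in>arcs G. g e = c"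
proof -
  define pick where "pick v = (SOME e. e \<in> out_arcs G v)" for v
  have pick: "pick v \<in> arcs G" "tail G (pick v) = v" if "v \<in> verts G" for v
  proof -
    have "out_arcs G v \<noteq> {}"
      using card_out_arcs[OF that] by auto
    then have "pick v \<in> out_arcs G v"
      unfolding pick_def by (rule some_in_eq[THEN iffD2])
    then show "pick v \<in> arcs G" "tail G (pick v) = v" by auto
  qed
  define H where "H v = g (pick v)" for v
  define K where "K v = T g (pick v)" for v
  have H: "g e = H (tail G e)" if "e \<in> arcs G" for e
    unfolding H_def using that
    by (intro constant_on_continuations_imp_tail[OF g]) (auto simp: pick)
  have K: "T g e = K (tail G e)" if "e \<in> arcs G" for e
    unfolding K_def using that
    by (intro constant_on_continuations_imp_tail[OF Tg]) (auto simp: pick)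
  have KH: "K (tail G a) = H (head G a)" if a: "a \<in> arcs G" for a
  proof -
    obtain e where e: "e \<in> cont a"
      using cont_nonempty[OF a] by blast
    then have "e \<in> arcs G" "tail G e = head G a"
      by (auto simp: continuations_def)
    then show ?thesis
      using g[OF a e] H K[OF a] by simp
  qed
  have HK: "H (tail G a) = K (head G a)" if a: "a \<in> arcs G" for a
    using KH[of "rv a"] a by simp
  obtain u0 where u0: "u0 \<in> verts G"
    using conn by (auto simp: Digraph_Component.connected_def strongly_connected_def)
  define c where "c = H u0"
  define d where "d = K u0"
  have dich: "H v = c \<and> K v = d \<or> H v = d \<and> K v = c" if "v \<in> verts G" for v
  proof (rule connected_propagate[OF conn u0 that])
    show "H u0 = c \<and> K u0 = d \<or> H u0 = d \<and> K u0 = c"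
      by (simp add: c_def d_def)
  qed (simp_all add: KH HK, blast+)
  show ?thesis
  proof (cases "c = d")
    case True
    then show ?thesis using dich H by (metis tail_in_verts)
  next
    case False
    have "bipartite G"
      unfolding bipartite_def
    proof (intro exI conjI ballI)
      show "verts G = {v \<in> verts G. H v = c} \<union> {v \<in> verts G. H v = d}"
        using dich by auto
      show "{v \<in> verts G. H v = c} \<inter> {v \<in> verts G. H v = d} = {}"
        using False by auto
    next
      fix e assume e: "e \<in> arcs G"
      then show "(tail G e \<in> {v \<in> verts G. H v = c} \<and> head G e \<in> {v \<in> verts G. H v = d}) \<or>
          (tail G e \<in> {v \<in> verts G. H v = d} \<and> head G e \<in> {v \<in> verts G. H v = c})"
        using dich[of "tail G e"] KH[OF e] by auto
    qed
    then show ?thesis using nb by simp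
  qed
qed

text \<open>
  A single step does not suffice: \<open>T g\<close> has the same norm as \<open>g\<close> whenever \<open>g\<close> depends on the tail
  only.
\<close>

lemma strict_contraction:
  assumes conn: "Digraph_Component.connected G" and nb: "\<not> bipartite G"
    and mean: "(\<Sum>e\<in>arcs G. g e) = 0" and pos: "0 < (\<Sum>e\<in>arcs G. (g e)\<^sup>2)"
  shows "(\<Sum>e\<in>arcs G. (T (T g) e)\<^sup>2) < (\<Sum>e\<in>arcs G. (g e)\<^sup>2)"
proof (rule ccontr)
  assume "\<not> ?thesis"
  then have "(\<Sum>e\<in>arcs G. (T (T g) e)\<^sup>2) = (\<Sum>e\<in>arcs G. (T g e)\<^sup>2)"
      "(\<Sum>e\<in>arcs G. (T g e)\<^sup>2) = (\<Sum>e\<in>arcs G. (g e)\<^sup>2)"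
    using nb_avg_energy_le[of "T g"] nb_avg_energy_le[of g] by linarith+
  then obtain c where c: "\<And>e. e \<in> arcs G \<Longrightarrow> g e = c"
    using rigidity[OF conn nb, of g] nb_avg_energy_eq_imp[of g] nb_avg_energy_eq_imp[of "T g"] by metis
  then have "real (card (arcs G)) * c = 0" "0 < real (card (arcs G)) * c\<^sup>2"
    using mean pos by (simp_all)
  then show False by auto
qed

lemma continuous_on_nb_avg:
  assumes "\<And>e. continuous_on UNIV (\<lambda>g. F g e)"
  shows "continuous_on UNIV (\<lambda>g. T (F g) a)"
  unfolding nb_avg_def average_def divide_inverse by (intro continuous_intros assms)

text \<open>
  The functions on arcs with sum zero and norm 1 form a compact set, on which the norm of \<open>T (T g)\<close>
  attains a maximum, which is less than 1 by the strict contraction. Arcs are elements of an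
  arbitrary type, so functions are extended by zero outside of \<open>arcs G\<close> and compactness comes from
  the product topology.
\<close>

lemma uniform_contraction:
  assumes conn: "Digraph_Component.connected G" and nb: "\<not> bipartite G"
  shows "\<exists>\<rho>. 0 \<le> \<rho> \<and> \<rho> < 1 \<and> (\<forall>g. (\<Sum>e\<in>arcs G. g e) = 0 \<longrightarrow>
     (\<Sum>e\<in>arcs G. (T (T g) e)\<^sup>2) \<le> \<rho> * (\<Sum>e\<in>arcs G. (g e)\<^sup>2))"
proof -
  let ?E = "arcs G"
  define N where "N g = (\<Sum>e\<in>?E. (g e)\<^sup>2)" for g :: "'b \<Rightarrow> real"
  define S :: "('b \<Rightarrow> real) set" where
    "S = {g. (\<forall>a. a \<notin> ?E \<longrightarrow> g a = 0) \<and> (\<Sum>e\<in>?E. g e) = 0 \<and> N g = 1}"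
  have coord: "continuous_on UNIV (\<lambda>g :: 'b \<Rightarrow> real. g a)" for a
    by (rule continuous_on_product_coordinates)
  have "compact S"
  proof -
    let ?B = "PiE UNIV (\<lambda>a. if a \<in> ?E then {-1..1} else {0 :: real})"
    have B: "compact ?B"
    proof -
      have "compactin (product_topology (\<lambda>i. euclidean) UNIV) ?B"
        by (subst compactin_PiE) auto
      then show ?thesis
        by (simp add: euclidean_product_topology)
    qed
    have "S \<subseteq> ?B"
    proof
      fix g assume g: "g \<in> S"
      have "\<bar>g e\<bar> \<le> 1" if "e \<in> ?E" for e
        using abs_le_L2_set[OF finite_arcs that, of g] g by (simp add: L2_set_def S_def N_def)
      then show "g \<in> ?B"
        using g by (fastforce simp: S_def PiE_def abs_le_iff)
    qed
    then have S: "S = ?B \<inter> ({g. \<forall>a. a \<notin> ?E \<longrightarrow> g a = 0} \<inter> {g. (\<Sum>e\<in>?E. g e) = 0} \<inter> {g. N g = 1})"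
      by (auto simp: S_def)
    have c1: "closed {g :: 'b \<Rightarrow> real. \<forall>a. a \<notin> ?E \<longrightarrow> g a = 0}"
      by (intro closed_Collect_all closed_Collect_imp closed_Collect_eq coord continuous_intros) auto
    have c2: "closed {g :: 'b \<Rightarrow> real. (\<Sum>e\<in>?E. g e) = 0}"
      by (intro closed_Collect_eq continuous_intros coord)
    have c3: "closed {g :: 'b \<Rightarrow> real. N g = 1}"
      unfolding N_def by (intro closed_Collect_eq continuous_intros coord)
    show ?thesis
      unfolding S by (intro compact_Int_closed closed_Int B c1 c2 c3)
  qed
  have cont: "continuous_on S (\<lambda>g. N (T (T g)))"
    unfolding N_def
    by (intro continuous_on_subset[OF _ subset_UNIV[of S]] continuous_intros continuous_on_nb_avg coord)
  have normalise: "N (T (T g)) \<le> \<rho> * N g"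
    if \<rho>: "\<And>h. h \<in> S \<Longrightarrow> N (T (T h)) \<le> \<rho>" and g: "(\<Sum>e\<in>?E. g e) = 0" for \<rho> g
  proof (cases "N g = 0")
    case True
    then have "N (T (T g)) \<le> 0"
      using nb_avg_energy_le[of g] nb_avg_energy_le[of "T g"] by (simp add: N_def)
    then show ?thesis using True by simp
  next
    case False
    then have pos: "0 < N g"
      by (simp add: N_def sum_nonneg less_le)
    define h where "h e = (if e \<in> ?E then g e / sqrt (N g) else 0)" for e
    have T_scale: "T (\<lambda>e. c * k e) = (\<lambda>e. c * T k e)" for c and k :: "'b \<Rightarrow> real"
      by (simp add: fun_eq_iff nb_avg_def average_def sum_distrib_left)
    have "T h = T (\<lambda>e. inverse (sqrt (N g)) * g e)"
      by (intro ext nb_avg_cong) (simp add: h_def field_simps)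
    then have TTh: "T (T h) = (\<lambda>e. inverse (sqrt (N g)) * T (T g) e)"
      by (simp add: T_scale)
    have "N h = N g / N g"
      using pos by (simp add: N_def h_def power_divide sum_nonneg flip: sum_divide_distrib)
    then have "h \<in> S"
      using pos g by (simp add: S_def h_def flip: sum_divide_distrib)
    moreover have "N (T (T h)) = N (T (T g)) / N g"
      unfolding TTh using pos
      by (simp add: N_def power_mult_distrib power_inverse sum_nonneg divide_inverse mult.commute
          flip: sum_distrib_left)
    ultimately show ?thesis
      using \<rho>[of h] pos by (simp add: divide_le_eq)
  qed
  show ?thesis
  proof (cases "S = {}")
    case True
    then have "N (T (T g)) \<le> 0 * N g" if "(\<Sum>e\<in>?E. g e) = 0" for g
      using that by (intro normalise) auto
    then show ?thesis
      unfolding N_def by (intro exI[of _ 0]) auto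
  next
    case False
    then obtain g0 where g0: "g0 \<in> S" "\<And>h. h \<in> S \<Longrightarrow> N (T (T h)) \<le> N (T (T g0))"
      using continuous_attains_sup[OF \<open>compact S\<close> _ cont] by blast
    have "N (T (T g0)) < 1"
      using strict_contraction[OF conn nb, of g0] g0(1) by (simp add: S_def N_def)
    moreover have "0 \<le> N (T (T g0))"
      by (simp add: N_def sum_nonneg)
    ultimately show ?thesis
      using normalise[of "N (T (T g0))"] g0(2) unfolding N_def by blast
  qed
qed

text \<open>
  The contraction is available for two steps at a time; the factor \<open>\<beta>\<close> on the left absorbs the odd
  step that may be left over.
\<close>

lemma geometric_decay:
  assumes \<beta>: "0 < \<beta>" "\<beta> \<le> 1"
    and contr: "\<And>g. (\<Sum>e\<in>arcs G. g e) = 0 \<Longrightarrow> L2_set (T (T g)) (arcs G) \<le> \<beta>\<^sup>2 * L2_set g (arcs G)"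
    and mean: "(\<Sum>e\<in>arcs G. g e) = 0"
  shows "\<beta> * L2_set ((T ^^ r) g) (arcs G) \<le> \<beta> ^ r * L2_set g (arcs G)"
  using mean
proof (induction r arbitrary: g rule: induct_nat_012)
  case 0
  then show ?case
    using \<beta> by (simp add: mult_left_le_one_le)
next
  case 1
  have "L2_set (T g) (arcs G) \<le> L2_set g (arcs G)"
    using nb_avg_energy_le[of g] by (simp add: L2_set_def)
  then show ?case
    using \<beta> by simp
next
  case (ge2 r)
  have "\<beta> * L2_set ((T ^^ r) (T (T g))) (arcs G) \<le> \<beta> ^ r * L2_set (T (T g)) (arcs G)"
    using ge2 by (simp add: sum_nb_avg)
  also have "\<dots> \<le> \<beta> ^ r * (\<beta>\<^sup>2 * L2_set g (arcs G))"
    using \<beta> ge2.prems by (intro mult_left_mono contr) auto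
  finally show ?case
    by (simp add: funpow_swap1 power2_eq_square mult_ac)
qed

lemma sum_arcs_head: "(\<Sum>e\<in>arcs G. h (head G e)) = real (q + 1) * (\<Sum>v\<in>verts G. h v)"
proof -
  have "(\<Sum>e\<in>arcs G. h (head G e)) = (\<Sum>v\<in>verts G. \<Sum>e | e \<in> arcs G \<and> head G e = v. h (head G e))"
    by (rule sum.group[symmetric]) auto
  also have "\<dots> = (\<Sum>v\<in>verts G. real (q + 1) * h v)"
  proof (intro sum.cong refl)
    fix v assume v: "v \<in> verts G"
    have "(\<Sum>e | e \<in> arcs G \<and> head G e = v. h (head G e)) = real (card (in_arcs G v)) * h v"
      by (simp add: in_arcs_def)
    then show "(\<Sum>e | e \<in> arcs G \<and> head G e = v. h (head G e)) = real (q + 1) * h v"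
      using card_in_arcs[OF v] by simp
  qed
  finally show ?thesis
    by (simp add: sum_distrib_left)
qed

lemma nb_avg_funpow_diff_const:
  "a \<in> arcs G \<Longrightarrow> (T ^^ r) (\<lambda>e. g e - c) a = (T ^^ r) g a - c"
proof (induction r arbitrary: a)
  case (Suc r)
  have "(T ^^ Suc r) (\<lambda>e. g e - c) a = T (\<lambda>e. (T ^^ r) g e - c) a"
    using Suc.IH by (auto intro!: nb_avg_cong)
  also have "\<dots> = (T ^^ Suc r) g a - c"
    using Suc.prems by (simp add: nb_avg_def average_diff_const finite_cont cont_nonempty)
  finally show ?case .
qed simp

text \<open>
  The exponent \<open>Suc r\<close> is the radius of the arc sphere to which the iterate \<open>r\<close> belongs.
\<close>

lemma exponential_mixing:
  assumes conn: "Digraph_Component.connected G" and nb: "\<not> bipartite G"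
  shows "\<exists>C \<beta>. 1 \<le> C \<and> real q powr (-1/2) \<le> \<beta> \<and> \<beta> < 1 \<and>
    (\<forall>f. \<forall>a\<in>arcs G. \<forall>r.
       \<bar>(T ^^ r) (\<lambda>e. f (head G e)) a - average f (verts G)\<bar> \<le> C * L2_set f (verts G) * \<beta> ^ Suc r)"
proof -
  obtain \<rho> where \<rho>: "0 \<le> \<rho>" "\<rho> < 1" and contr: "\<And>g. (\<Sum>e\<in>arcs G. g e) = 0 \<Longrightarrow>
      (\<Sum>e\<in>arcs G. (T (T g) e)\<^sup>2) \<le> \<rho> * (\<Sum>e\<in>arcs G. (g e)\<^sup>2)"
    using uniform_contraction[OF conn nb] by blast
  \<comment> \<open>Two steps contract the norm, not its square, by \<open>\<beta>\<^sup>2\<close>, which takes a fourth root of \<open>\<rho>\<close>.\<close>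
  define \<beta> where "\<beta> = max (real q powr (-1/2)) (sqrt (sqrt \<rho>))"
  have \<beta>: "0 < \<beta>" "\<beta> < 1" "sqrt (sqrt \<rho>) \<le> \<beta>"
    using \<rho> q_ge_2 by (auto simp: \<beta>_def less_max_iff_disj powr_less_one)
  have "sqrt \<rho> = (sqrt (sqrt \<rho>))\<^sup>2"
    using \<rho> by simp
  also have "\<dots> \<le> \<beta>\<^sup>2"
    using \<beta>(3) \<rho> by (intro power_mono) auto
  finally have sq: "sqrt \<rho> \<le> \<beta>\<^sup>2" .
  have L2: "L2_set (T (T g)) (arcs G) \<le> \<beta>\<^sup>2 * L2_set g (arcs G)" if "(\<Sum>e\<in>arcs G. g e) = 0" for g
  proof -
    have "L2_set (T (T g)) (arcs G) \<le> sqrt (\<rho> * (\<Sum>e\<in>arcs G. (g e)\<^sup>2))"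
      unfolding L2_set_def using contr[OF that] by simp
    also have "\<dots> = sqrt \<rho> * L2_set g (arcs G)"
      by (simp add: L2_set_def real_sqrt_mult)
    also have "\<dots> \<le> \<beta>\<^sup>2 * L2_set g (arcs G)"
      using sq by (intro mult_right_mono) (auto simp: L2_set_nonneg)
    finally show ?thesis .
  qed
  \<comment> \<open>Each vertex is the head of \<open>q + 1\<close> arcs. One factor \<open>1 / \<beta>\<close> comes from the odd step, the other
    from counting \<open>Suc r\<close> instead of \<open>r\<close> steps.\<close>
  define C where "C = sqrt (real (q + 1)) / \<beta>\<^sup>2"
  have "1 * \<beta>\<^sup>2 \<le> sqrt (real (q + 1))"
  proof -
    have "\<beta>\<^sup>2 \<le> 1"
      using \<beta> by (simp add: power_le_one)
    also have "1 \<le> sqrt (real (q + 1))"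
      by simp
    finally show ?thesis by simp
  qed
  then have C1: "1 \<le> C"
    using \<beta> by (simp add: C_def le_divide_eq)
  have "\<bar>(T ^^ r) (\<lambda>e. f (head G e)) a - average f (verts G)\<bar> \<le> C * L2_set f (verts G) * \<beta> ^ Suc r"
    if a: "a \<in> arcs G" for f a r
  proof -
    define m where "m = average f (verts G)"
    define g where "g e = f (head G e) - m" for e
    have V: "verts G \<noteq> {}"
      using tail_in_verts[OF a] by blast
    have "(\<Sum>v\<in>verts G. f v - m) = 0"
      by (simp add: sum_eq_card_average average_diff_const V m_def)
    then have g0: "(\<Sum>e\<in>arcs G. g e) = 0"
      unfolding g_def using sum_arcs_head[of "\<lambda>v. f v - m"] by simp
    have "L2_set g (arcs G) = sqrt (real (q + 1)) * L2_set (\<lambda>v. f v - m) (verts G)"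
      unfolding g_def L2_set_def sum_arcs_head[of "\<lambda>v. (f v - m)\<^sup>2"] by (rule real_sqrt_mult)
    also have "\<dots> \<le> sqrt (real (q + 1)) * L2_set f (verts G)"
      unfolding m_def by (intro mult_left_mono L2_set_deviation_le) auto
    finally have g_le: "L2_set g (arcs G) \<le> sqrt (real (q + 1)) * L2_set f (verts G)" .
    have "\<beta> * \<bar>(T ^^ r) g a\<bar> \<le> \<beta> * L2_set ((T ^^ r) g) (arcs G)"
      using \<beta> a by (intro mult_left_mono abs_le_L2_set) auto
    also have "\<dots> \<le> \<beta> ^ r * L2_set g (arcs G)"
      using \<beta> L2 g0 by (intro geometric_decay) auto
    also have "\<dots> \<le> \<beta> ^ r * (sqrt (real (q + 1)) * L2_set f (verts G))"
      using \<beta> g_le by (intro mult_left_mono) auto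
    also have "\<dots> = \<beta> * (C * L2_set f (verts G) * \<beta> ^ Suc r)"
      using \<beta> by (simp add: C_def power2_eq_square)
    finally have "\<bar>(T ^^ r) g a\<bar> \<le> C * L2_set f (verts G) * \<beta> ^ Suc r"
      using \<beta> by simp
    then show ?thesis
      using nb_avg_funpow_diff_const[OF a, of r "\<lambda>e. f (head G e)" m] unfolding g_def m_def by simp
  qed
  moreover have "real q powr (-1/2) \<le> \<beta>"
    by (simp add: \<beta>_def)
  ultimately show ?thesis
    using C1 \<beta> by blast
qed

end

section \<open>Distance between words\<close>

text \<open>
  The distance of two words in the tree of all words, where a word is joined to its extensions by
  one letter: the number of letters after the longest common prefix.
\<close>

fun word_dist :: "'b list \<Rightarrow> 'b list \<Rightarrow> nat" where
  "word_dist [] w = length w"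
| "word_dist (x # v) [] = Suc (length v)"
| "word_dist (x # v) (y # w) = (if x = y then word_dist v w else length v + length w + 2)"

lemma word_dist_Nil2: "word_dist v [] = length v"
  by (cases v) auto

lemma word_dist_eq_0_iff: "word_dist v w = 0 \<longleftrightarrow> v = w"
  by (induction v w rule: word_dist.induct) auto

lemma word_dist_snoc:
  "if prefix (p @ [e]) v then word_dist v p = Suc (word_dist v (p @ [e]))
   else word_dist v (p @ [e]) = Suc (word_dist v p)"
  by (induction v p rule: word_dist.induct) (auto simp: prefix_Cons word_dist_Nil2 split: if_splits)

section \<open>The universal cover as a tree\<close>

locale rooted_graph = bidirected_digraph G rv
  for G :: "('a, 'b) pre_digraph" and rv :: "'b \<Rightarrow> 'b" +
  fixes base :: 'a
  assumes base: "base \<in> verts G"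
begin

abbreviation "cover \<equiv> universal_cover G rv base"
abbreviation "\<pi> \<equiv> cover_proj G base"
abbreviation "\<delta> \<equiv> graph_dist cover"

text \<open>
  The neighbour of \<open>p\<close> reached by lifting the arc \<open>e\<close>; the lift shortens \<open>p\<close> if \<open>e\<close> undoes its last arc.
\<close>

definition neighbour :: "'b list \<Rightarrow> 'b \<Rightarrow> 'b list" where
  "neighbour p e = (if p \<noteq> [] \<and> e = rv (last p) then butlast p else p @ [e])"

lemma verts_cover: "verts cover = nonbacktracking_walks G rv base"
  and tail_cover [simp]: "tail cover = fst"
  and head_cover [simp]: "head cover = snd"
  by (simp_all add: universal_cover_def)

lemma arcs_cover_iff:
  "(p, p') \<in> arcs cover \<longleftrightarrow> p \<in> verts cover \<and> p' \<in> verts cover \<and> (\<exists>e. p' = p @ [e] \<or> p = p' @ [e])"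
  by (simp add: universal_cover_def)

lemma arcs_cover_sym: "(p, p') \<in> arcs cover \<Longrightarrow> (p', p) \<in> arcs cover"
  by (auto simp: arcs_cover_iff)

lemma wf_cover: "wf_digraph cover"
  by unfold_locales (auto simp: arcs_cover_iff)

lemma cover_proj_Nil [simp]: "\<pi> [] = base"
  by (simp add: cover_proj_def)

lemma cover_proj_snoc [simp]: "\<pi> (p @ [e]) = head G e"
proof -
  have "awlast u (p @ [e]) = head G e" for u
    by (induction p arbitrary: u) auto
  then show ?thesis
    by (simp add: cover_proj_def)
qed

lemma cover_proj_singleton [simp]: "\<pi> [e] = head G e"
  using cover_proj_snoc[of "[]"] by simp

lemma Nil_in_cover: "[] \<in> verts cover"
  using base by (auto simp: verts_cover nonbacktracking_walks_def awalk_Nil_iff)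

lemma snoc_in_cover_iff:
  "p @ [e] \<in> verts cover \<longleftrightarrow>
     p \<in> verts cover \<and> e \<in> out_arcs G (\<pi> p) \<and> (p \<noteq> [] \<longrightarrow> e \<noteq> rv (last p))"
proof -
  have "(\<exists>v. awalk base (p @ [e]) v) \<longleftrightarrow> (\<exists>v. awalk base p v) \<and> e \<in> out_arcs G (\<pi> p)"
  proof -
    have "awalk base (p @ [e]) v \<longleftrightarrow> awalk base p (\<pi> p) \<and> e \<in> out_arcs G (\<pi> p) \<and> v = head G e" for v
      by (auto simp: cover_proj_def awalk_simps)
    moreover have "(\<exists>v. awalk base p v) \<longleftrightarrow> awalk base p (\<pi> p)"
      by (auto simp: cover_proj_def dest: awalk_ends)
    ultimately show ?thesis
      by simp
  qed
  moreover have "successively (\<lambda>e e'. e' \<noteq> rv e) (p @ [e]) \<longleftrightarrow>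
      successively (\<lambda>e e'. e' \<noteq> rv e) p \<and> (p \<noteq> [] \<longrightarrow> e \<noteq> rv (last p))"
    by (auto simp: successively_append_iff)
  ultimately show ?thesis
    unfolding verts_cover nonbacktracking_walks_def mem_Collect_eq by blast
qed

lemma singleton_in_cover_iff: "[e] \<in> verts cover \<longleftrightarrow> e \<in> out_arcs G base"
  using snoc_in_cover_iff[of "[]" e] Nil_in_cover by simp

lemma cover_prefix_closed: "prefix p v \<Longrightarrow> v \<in> verts cover \<Longrightarrow> p \<in> verts cover"
proof (induction v rule: rev_induct)
  case (snoc x v)
  then show ?case
    using snoc_in_cover_iff[of v x] by (cases "p = v @ [x]") auto
qed simp

lemma cover_proj_in_verts: "p \<in> verts cover \<Longrightarrow> \<pi> p \<in> verts G"
  by (cases p rule: rev_cases) (auto simp: base snoc_in_cover_iff singleton_in_cover_iff)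

text \<open>
  Existence of lifts of arcs. Lifting the reverse arc leads back.
\<close>

lemma neighbour:
  assumes p: "p \<in> verts cover" and e: "e \<in> out_arcs G (\<pi> p)"
  shows "(p, neighbour p e) \<in> arcs cover" (is ?arc)
    and "\<pi> (neighbour p e) = head G e" (is ?proj)
    and "cover_proj_arc rv (p, neighbour p e) = e" (is ?lift)
    and "neighbour (neighbour p e) (rv e) = p" (is ?back)
proof -
  have "?arc \<and> ?proj \<and> ?lift \<and> ?back"
  proof (cases "p \<noteq> [] \<and> e = rv (last p)")
    case True
    then obtain p0 x where [simp]: "p = p0 @ [x]"
      by (cases p rule: rev_cases) auto
    show ?thesis
      using True p e by (auto simp: neighbour_def arcs_cover_iff snoc_in_cover_iff singleton_in_cover_iff cover_proj_arc_def)
  next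
    case False
    then show ?thesis
      using p e by (auto simp: neighbour_def arcs_cover_iff snoc_in_cover_iff singleton_in_cover_iff cover_proj_arc_def)
  qed
  then show ?arc ?proj ?lift ?back by auto
qed

text \<open>
  Uniqueness of lifts: every arc of the cover is the lift of the arc below it.
\<close>

lemma arcs_cover_lift:
  assumes "(p, p') \<in> arcs cover"
  shows "p \<in> verts cover \<and> cover_proj_arc rv (p, p') \<in> out_arcs G (\<pi> p) \<and>
    p' = neighbour p (cover_proj_arc rv (p, p'))"
  using assms by (auto simp: arcs_cover_iff cover_proj_arc_def neighbour_def snoc_in_cover_iff singleton_in_cover_iff)

lemma neighbours_of:
  assumes "p \<in> verts cover"
  shows "{p'. (p, p') \<in> arcs cover} = neighbour p ` out_arcs G (\<pi> p)"
  using assms arcs_cover_lift neighbour(1) by blast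

lemma inj_neighbour: "p \<in> verts cover \<Longrightarrow> inj_on (neighbour p) (out_arcs G (\<pi> p))"
  using neighbour(3) by (metis inj_onI)

text \<open>
  Among the neighbours of \<open>p'\<close>, the one to exclude is \<open>p\<close>, and it lies above \<open>rv a\<close>. So nonbacktracking
  steps in the cover correspond to nonbacktracking steps in \<open>G\<close>.
\<close>

lemma forward_neighbours:
  assumes p: "p \<in> verts cover" and a: "a \<in> out_arcs G (\<pi> p)"
  defines "p' \<equiv> neighbour p a"
  shows "{p''. (p', p'') \<in> arcs cover \<and> p'' \<noteq> p} = neighbour p' ` continuations G rv a"
    and "inj_on (neighbour p') (continuations G rv a)"
proof -
  have p': "p' \<in> verts cover" and \<pi>: "\<pi> p' = head G a" and return: "neighbour p' (rv a) = p"
    using neighbour[OF p a] by (simp_all add: p'_def arcs_cover_iff)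
  have rva: "rv a \<in> out_arcs G (\<pi> p')"
    using a by (simp add: \<pi>)
  have inj: "inj_on (neighbour p') (out_arcs G (\<pi> p'))"
    using p' by (rule inj_neighbour)
  then show "inj_on (neighbour p') (continuations G rv a)"
    by (rule inj_on_subset) (auto simp: continuations_def \<pi>)
  have "{p''. (p', p'') \<in> arcs cover \<and> p'' \<noteq> p} = neighbour p' ` out_arcs G (\<pi> p') - neighbour p' ` {rv a}"
    using neighbours_of[OF p'] return by auto
  also have "\<dots> = neighbour p' ` (out_arcs G (\<pi> p') - {rv a})"
    using inj rva by (simp add: inj_on_image_set_diff[where C = "out_arcs G (\<pi> p')"])
  finally show "{p''. (p', p'') \<in> arcs cover \<and> p'' \<noteq> p} = neighbour p' ` continuations G rv a"
    by (simp add: continuations_def \<pi>)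
qed

text \<open>
  This is the tree property of the cover. If \<open>p\<close> is a proper prefix of \<open>v\<close>, the closer neighbour
  appends the next letter of \<open>v\<close>; otherwise it deletes the last letter of \<open>p\<close>.
\<close>

lemma word_dist_closer:
  assumes v: "v \<in> verts cover" and p: "p \<in> verts cover" and "v \<noteq> p"
  shows "\<exists>!p'. (p, p') \<in> arcs cover \<and> word_dist v p = Suc (word_dist v p')"
proof (cases "prefix p v")
  case True
  then obtain e w where vw: "v = p @ e # w"
    using \<open>v \<noteq> p\<close> by (metis append_Nil2 neq_Nil_conv prefixE)
  have pre: "prefix (p @ [e]) v"
    by (simp add: vw)
  show ?thesis
  proof (rule ex1I[of _ "p @ [e]"])
    show "(p, p @ [e]) \<in> arcs cover \<and> word_dist v p = Suc (word_dist v (p @ [e]))"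
      using word_dist_snoc[of p e v] pre p v cover_prefix_closed[OF pre] by (auto simp: arcs_cover_iff)
  next
    fix p' assume p': "(p, p') \<in> arcs cover \<and> word_dist v p = Suc (word_dist v p')"
    then consider x where "p' = p @ [x]" | x where "p = p' @ [x]"
      by (auto simp: arcs_cover_iff)
    then show "p' = p @ [e]"
    proof cases
      case 1
      then show ?thesis
        using word_dist_snoc[of p x v] p' by (auto simp: vw split: if_splits)
    next
      case 2
      then show ?thesis
        using word_dist_snoc[of p' x v] p' True by simp
    qed
  qed
next
  case False
  then obtain p0 x where px: "p = p0 @ [x]"
    by (cases p rule: rev_cases) auto
  show ?thesis
  proof (rule ex1I[of _ p0])
    show "(p, p0) \<in> arcs cover \<and> word_dist v p = Suc (word_dist v p0)"
      using word_dist_snoc[of p0 x v] False p by (auto simp: arcs_cover_iff px snoc_in_cover_iff)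
  next
    fix p' assume p': "(p, p') \<in> arcs cover \<and> word_dist v p = Suc (word_dist v p')"
    then consider e where "p' = p @ [e]" | e where "p = p' @ [e]"
      by (auto simp: arcs_cover_iff)
    then show "p' = p0"
    proof cases
      case 1
      then show ?thesis
        using word_dist_snoc[of p e v] p' False append_prefixD[of p "[e]" v] by (simp split: if_splits)
    qed (simp add: px)
  qed
qed

lemma word_dist_step:
  "(p, p') \<in> arcs cover \<Longrightarrow> word_dist v p = Suc (word_dist v p') \<or> word_dist v p' = Suc (word_dist v p)"
  unfolding arcs_cover_iff using word_dist_snoc by metis

text \<open>
  Walks cannot be shorter, as each arc changes \<open>word_dist v\<close> by one; walking along closer neighbours
  attains the bound.
\<close>

lemma graph_dist_eq_word_dist:
  assumes v: "v \<in> verts cover" and p: "p \<in> verts cover"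
  shows "\<delta> v p = word_dist v p"
proof -
  interpret C: wf_digraph cover
    by (rule wf_cover)
  have upper: "\<exists>w. C.awalk v w p \<and> length w = word_dist v p"
    using p
  proof (induction "word_dist v p" arbitrary: p)
    case 0
    then have "v = p"
      by (metis word_dist_eq_0_iff)
    then show ?case
      using 0 v by (auto intro!: exI[of _ "[]"] simp: C.awalk_Nil_iff)
  next
    case (Suc n)
    then have "v \<noteq> p"
      using word_dist_eq_0_iff[of v p] by auto
    then obtain p' where p': "(p, p') \<in> arcs cover" "word_dist v p = Suc (word_dist v p')"
      using word_dist_closer[OF v Suc.prems] by blast
    moreover have "p' \<in> verts cover"
      using p' by (simp add: arcs_cover_iff)
    ultimately obtain w where w: "C.awalk v w p'" "length w = word_dist v p'"
      using Suc by auto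
    have "C.awalk v (w @ [(p', p)]) p"
      using w(1) arcs_cover_sym[OF p'(1)] Suc.prems
      by (auto simp: C.awalk_simps)
    then show ?case
      using w(2) p'(2) by (intro exI[of _ "w @ [(p', p)]"]) auto
  qed
  have lower: "word_dist v z \<le> word_dist v u + length w" if "C.awalk u w z" for u w z
    using that
  proof (induction w arbitrary: u)
    case Nil
    then show ?case by (simp add: C.awalk_Nil_iff)
  next
    case (Cons e w)
    then have "(u, snd e) \<in> arcs cover" "C.awalk (snd e) w z"
      by (auto simp: C.awalk_Cons_iff)
    then show ?case
      using Cons.IH[of "snd e"] word_dist_step[of u "snd e" v] by auto
  qed
  have "word_dist v v = 0"
    by (simp add: word_dist_eq_0_iff)
  then show ?thesis
    unfolding graph_dist_def using upper lower[of v _ p] by (intro Least_equality) auto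
qed

lemma dist_step:
  assumes "v \<in> verts cover" "(p, p') \<in> arcs cover"
  shows "\<delta> v p = Suc (\<delta> v p') \<or> \<delta> v p' = Suc (\<delta> v p)"
  using word_dist_step[OF assms(2), of v] assms by (simp add: graph_dist_eq_word_dist arcs_cover_iff)

lemma dist_eq_0_iff: "v \<in> verts cover \<Longrightarrow> p \<in> verts cover \<Longrightarrow> \<delta> v p = 0 \<longleftrightarrow> v = p"
  by (simp add: graph_dist_eq_word_dist word_dist_eq_0_iff)

text \<open>
  The orientation of the tree toward \<open>v\<close>: it contains one of the two arcs of each edge, and
  exactly one arc out of every vertex other than \<open>v\<close>.
\<close>

definition toward :: "'b list \<Rightarrow> ('b list \<times> 'b list) set" where
  "toward v = {(p, p'). (p, p') \<in> arcs cover \<and> \<delta> v p = Suc (\<delta> v p')}"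

lemma ex1_toward:
  assumes "v \<in> verts cover" "p \<in> verts cover" "v \<noteq> p"
  shows "\<exists>!p'. (p, p') \<in> toward v"
proof -
  have "(p, p') \<in> toward v \<longleftrightarrow> (p, p') \<in> arcs cover \<and> word_dist v p = Suc (word_dist v p')" for p'
    using assms by (auto simp: toward_def arcs_cover_iff graph_dist_eq_word_dist)
  then show ?thesis
    using word_dist_closer[OF assms] by simp
qed

lemma toward_unique:
  assumes "v \<in> verts cover" "(p, p1) \<in> toward v" "(p, p2) \<in> toward v"
  shows "p1 = p2"
proof -
  have p: "p \<in> verts cover" and "\<delta> v p = Suc (\<delta> v p1)"
    using assms by (auto simp: toward_def arcs_cover_iff)
  then have "v \<noteq> p"
    using dist_eq_0_iff[of v p] assms(1) by auto
  then show ?thesis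
    using ex1_toward[OF assms(1) p] assms(2,3) by blast
qed

lemma toward_cases:
  assumes "v \<in> verts cover" "(p, p') \<in> arcs cover"
  shows "(p, p') \<in> toward v \<or> (p', p) \<in> toward v"
  using dist_step[OF assms] assms(2) arcs_cover_sym by (auto simp: toward_def)

lemma arc_sphere_Suc_iff:
  assumes "(p, p') \<in> arcs cover"
  shows "v \<in> arc_sphere cover (p, p') (Suc r) \<longleftrightarrow>
    v \<in> verts cover \<and> (p, p') \<in> toward v \<and> \<delta> v p' = r"
  using assms by (auto simp: graph_sphere_def toward_def)

lemma arc_sphere_1:
  assumes "(p, p') \<in> arcs cover"
  shows "arc_sphere cover (p, p') (Suc 0) = {p'}"
proof -
  have p': "p' \<in> verts cover" "p \<in> verts cover"
    using assms by (simp_all add: arcs_cover_iff)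
  then have "\<delta> p' p' = 0"
    by (simp add: dist_eq_0_iff)
  then have "(p, p') \<in> toward p'"
    using toward_cases[OF p'(1) assms] by (auto simp: toward_def)
  then show ?thesis
    using p' dist_eq_0_iff \<open>\<delta> p' p' = 0\<close> by (auto simp: arc_sphere_Suc_iff[OF assms] simp del: arc_sphere.simps)
qed

text \<open>
  If \<open>v\<close> lies behind the arc from \<open>p\<close> to \<open>p'\<close>, then the arc that points from \<open>p'\<close> to \<open>v\<close> does not lead back
  to \<open>p\<close>. Conversely, if that arc leads elsewhere, then by uniqueness the arc from \<open>p\<close> to \<open>p'\<close> points to \<open>v\<close>.
\<close>

lemma arc_sphere_Suc_Suc:
  assumes pp': "(p, p') \<in> arcs cover"
  shows "arc_sphere cover (p, p') (Suc (Suc r)) =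
    (\<Union>p'' \<in> {p''. (p', p'') \<in> arcs cover \<and> p'' \<noteq> p}. arc_sphere cover (p', p'') (Suc r))"
    (is "?L = ?R")
proof (intro set_eqI iffI)
  fix v assume "v \<in> ?L"
  then have v: "v \<in> verts cover" and tow: "(p, p') \<in> toward v" and d: "\<delta> v p' = Suc r"
    using arc_sphere_Suc_iff[OF pp'] by blast+
  then have "v \<noteq> p'"
    using dist_eq_0_iff[of v p'] pp' by (auto simp: arcs_cover_iff)
  then obtain p'' where p'': "(p', p'') \<in> toward v"
    using ex1_toward[OF v, of p'] pp' by (auto simp: arcs_cover_iff)
  then have "(p', p'') \<in> arcs cover" "p'' \<noteq> p" "\<delta> v p'' = r"
    using tow d by (auto simp: toward_def)
  then show "v \<in> ?R"
    using v p'' arc_sphere_Suc_iff by blast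
next
  fix v assume "v \<in> ?R"
  then obtain p'' where p'': "(p', p'') \<in> arcs cover" "p'' \<noteq> p"
    and "v \<in> arc_sphere cover (p', p'') (Suc r)" by blast
  then have v: "v \<in> verts cover" and tow: "(p', p'') \<in> toward v" and d: "\<delta> v p'' = r"
    using arc_sphere_Suc_iff by blast+
  then have "(p', p) \<notin> toward v"
    using toward_unique p''(2) by blast
  then have "(p, p') \<in> toward v"
    using toward_cases[OF v pp'] by blast
  moreover have "\<delta> v p' = Suc r"
    using tow d by (simp add: toward_def)
  ultimately show "v \<in> ?L"
    using v arc_sphere_Suc_iff[OF pp'] by blast
qed

lemma arc_sphere_disjoint:
  assumes "(p, p1) \<in> arcs cover" "(p, p2) \<in> arcs cover" "p1 \<noteq> p2"
  shows "arc_sphere cover (p, p1) (Suc r) \<inter> arc_sphere cover (p, p2) (Suc r) = {}"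
  using arc_sphere_Suc_iff[OF assms(1)] arc_sphere_Suc_iff[OF assms(2)] toward_unique assms(3) by blast

section \<open>Tubes as unions of arc spheres\<close>

text \<open>
  Following the arcs toward \<open>v\<close> from any \<open>z\<close> in \<open>X\<close>, one passes through \<open>x\<close>. This property spreads along
  the edges of \<open>X\<close>: it can only fail in a step away from \<open>x\<close> toward \<open>v\<close>, but that step leads to \<open>y\<close>,
  outside of \<open>X\<close>.
\<close>

lemma gate:
  assumes sub: "subgraph X cover" and conn: "Digraph_Component.connected X"
    and v: "v \<in> verts cover" and x: "x \<in> verts X" "(x, y) \<in> toward v" "y \<notin> verts X"
    and z: "z \<in> verts X"
  shows "(z, x) \<in> (toward v)\<^sup>*"
proof (rule connected_propagate[OF conn x(1) z])
  have arcsX: "e \<in> arcs cover" "tail X e = fst e" "head X e = snd e" "fst e \<in> verts X" "snd e \<in> verts X"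
    if e: "e \<in> arcs X" for e
  proof -
    have X: "wf_digraph X" "compatible cover X" "arcs X \<subseteq> arcs cover"
      using sub by (auto simp: subgraph_def)
    then show "e \<in> arcs cover" "tail X e = fst e" "head X e = snd e"
      using e by (auto simp: compatible_def)
    then show "fst e \<in> verts X" "snd e \<in> verts X"
      using wf_digraph.tail_in_verts[OF X(1) e] wf_digraph.head_in_verts[OF X(1) e] by auto
  qed
  have move: "(z', x) \<in> (toward v)\<^sup>*"
    if "(z, z') \<in> arcs cover" "z' \<in> verts X" "(z, x) \<in> (toward v)\<^sup>*" for z z'
  proof (cases "(z', z) \<in> toward v")
    case True
    then show ?thesis
      using that(3) by (rule converse_rtrancl_into_rtrancl)
  next
    case False
    then have zz': "(z, z') \<in> toward v"
      using toward_cases[OF v that(1)] by blast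
    show ?thesis
      using that(3)
    proof (cases rule: converse_rtranclE)
      case base
      then show ?thesis
        using toward_unique[OF v zz'] x(2,3) that(2) by blast
    next
      case (step z'')
      then show ?thesis
        using toward_unique[OF v zz'] by blast
    qed
  qed
  show "(x, x) \<in> (toward v)\<^sup>*" by simp
  fix e assume e: "e \<in> arcs X"
  show "(head X e, x) \<in> (toward v)\<^sup>*" if "(tail X e, x) \<in> (toward v)\<^sup>*"
    using move[of "fst e" "snd e"] arcsX[OF e] that by simp
  show "(tail X e, x) \<in> (toward v)\<^sup>*" if "(head X e, x) \<in> (toward v)\<^sup>*"
    using move[of "snd e" "fst e"] arcs_cover_sym[of "fst e" "snd e"] arcsX[OF e] that by simp
qed

lemma dist_less_along_toward: "(z, x) \<in> (toward v)\<^sup>* \<Longrightarrow> \<delta> v x < \<delta> v z \<or> x = z"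
  by (induction rule: rtrancl_induct) (auto simp: toward_def)

definition boundary :: "('b list, 'b list \<times> 'b list) pre_digraph \<Rightarrow> ('b list \<times> 'b list) set" where
  "boundary X = {(x, y) \<in> arcs cover. x \<in> verts X \<and> y \<notin> verts X}"

text \<open>
  A vertex of the tube lies behind the arc from a nearest vertex of \<open>X\<close> toward it, which leaves \<open>X\<close> by
  minimality. Conversely, the tail of an arc that leaves \<open>X\<close> toward \<open>v\<close> is a vertex of \<open>X\<close> nearest to \<open>v\<close>, as
  all of \<open>X\<close> is seen through it.
\<close>

lemma vertex_tube_Suc:
  assumes sub: "subgraph X cover" and fin: "finite (verts X)" and conn: "Digraph_Component.connected X"
  shows "vertex_tube cover X (Suc r) = (\<Union>l\<in>boundary X. arc_sphere cover l (Suc r))"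
proof (intro set_eqI iffI)
  fix v assume tube: "v \<in> vertex_tube cover X (Suc r)"
  have ne: "verts X \<noteq> {}"
    using conn by (auto simp: Digraph_Component.connected_def strongly_connected_def)
  have v: "v \<in> verts cover" and min: "Min (\<delta> v ` verts X) = Suc r"
    using tube by (auto simp: vertex_tube_def)
  then obtain x where x: "x \<in> verts X" "\<delta> v x = Suc r"
    using Min_in[of "\<delta> v ` verts X"] fin ne by (metis finite_imageI image_iff image_is_empty)
  have xc: "x \<in> verts cover"
    using x(1) sub by (auto simp: subgraph_def)
  have "v \<noteq> x"
    using x(2) dist_eq_0_iff[OF v xc] by auto
  then obtain y where y: "(x, y) \<in> toward v"
    using ex1_toward[OF v xc] by blast
  then have "\<delta> v y = r" "(x, y) \<in> arcs cover"
    using x(2) by (auto simp: toward_def)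
  moreover have "y \<notin> verts X"
    using Min_le[of "\<delta> v ` verts X" "\<delta> v y"] fin min \<open>\<delta> v y = r\<close> by auto
  ultimately have "(x, y) \<in> boundary X" "v \<in> arc_sphere cover (x, y) (Suc r)"
    using x(1) v y by (auto simp: boundary_def arc_sphere_Suc_iff simp del: arc_sphere.simps)
  then show "v \<in> (\<Union>l\<in>boundary X. arc_sphere cover l (Suc r))" by blast
next
  fix v assume "v \<in> (\<Union>l\<in>boundary X. arc_sphere cover l (Suc r))"
  then obtain x y where xy: "(x, y) \<in> arcs cover" "x \<in> verts X" "y \<notin> verts X"
    and "v \<in> arc_sphere cover (x, y) (Suc r)"
    by (auto simp: boundary_def simp del: arc_sphere.simps)
  then have v: "v \<in> verts cover" and tow: "(x, y) \<in> toward v" and "\<delta> v y = r"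
    using arc_sphere_Suc_iff[OF xy(1)] by blast+
  then have d: "\<delta> v x = Suc r"
    by (simp add: toward_def)
  have "Min (\<delta> v ` verts X) = \<delta> v x"
    using dist_less_along_toward[OF gate[OF sub conn v xy(2) tow xy(3)]] xy(2) fin
    by (intro Min_eqI) fastforce+
  then show "v \<in> vertex_tube cover X (Suc r)"
    using v d by (simp add: vertex_tube_def)
qed

lemma boundary_arc_spheres_disjoint:
  assumes sub: "subgraph X cover" and conn: "Digraph_Component.connected X"
    and l: "l \<in> boundary X" "l' \<in> boundary X" "l \<noteq> l'"
  shows "arc_sphere cover l (Suc r) \<inter> arc_sphere cover l' (Suc r) = {}"
proof (rule ccontr)
  obtain x y x' y' where [simp]: "l = (x, y)" "l' = (x', y')"
    by (metis surj_pair)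
  have xy: "(x, y) \<in> arcs cover" "x \<in> verts X" "y \<notin> verts X"
    "(x', y') \<in> arcs cover" "x' \<in> verts X" "y' \<notin> verts X"
    using l by (auto simp: boundary_def)
  assume "\<not> ?thesis"
  then obtain v where "v \<in> arc_sphere cover (x, y) (Suc r)" "v \<in> arc_sphere cover (x', y') (Suc r)"
    by (auto simp del: arc_sphere.simps)
  then have v: "v \<in> verts cover" and tow: "(x, y) \<in> toward v" "(x', y') \<in> toward v"
    using arc_sphere_Suc_iff xy by blast+
  have "x = x'"
    using dist_less_along_toward[OF gate[OF sub conn v xy(2) tow(1) xy(3) xy(5)]]
      dist_less_along_toward[OF gate[OF sub conn v xy(5) tow(2) xy(6) xy(2)]] by auto
  then show False
    using toward_unique[OF v] tow l(3) by auto
qed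

end

section \<open>Averages over arc spheres and tubes\<close>

locale rooted_regular_graph = regular_graph G rv q + rooted_graph G rv base
  for G :: "('a, 'b) pre_digraph" and rv :: "'b \<Rightarrow> 'b" and q :: nat and base :: 'a
begin

text \<open>
  The partition of an arc sphere into the spheres behind the next arcs turns into one more
  application of \<open>q\<close> times \<open>T\<close>. The case \<open>h = 1\<close> counts the sphere.
\<close>

lemma sum_arc_sphere:
  assumes "p \<in> verts cover" "a \<in> out_arcs G (\<pi> p)"
  shows "finite (arc_sphere cover (p, neighbour p a) (Suc r)) \<and>
    (\<Sum>x\<in>arc_sphere cover (p, neighbour p a) (Suc r). h (\<pi> x))
      = real q ^ r * (T ^^ r) (\<lambda>e. h (head G e)) a"
  using assms
proof (induction r arbitrary: p a)
  case 0
  then show ?case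
    using arc_sphere_1[OF neighbour(1)[OF 0]] neighbour(2)[OF 0] by (simp del: arc_sphere.simps)
next
  case (Suc r)
  define p' where "p' = neighbour p a"
  have pp': "(p, p') \<in> arcs cover" and \<pi>: "\<pi> p' = head G a"
    using neighbour[OF Suc.prems] by (simp_all add: p'_def)
  have p': "p' \<in> verts cover"
    using pp' by (simp add: arcs_cover_iff)
  have cont: "e \<in> out_arcs G (\<pi> p')" if "e \<in> cont a" for e
    using that by (simp add: continuations_def \<pi>)
  have sphere: "arc_sphere cover (p, p') (Suc (Suc r)) =
      (\<Union>e\<in>cont a. arc_sphere cover (p', neighbour p' e) (Suc r))"
    unfolding arc_sphere_Suc_Suc[OF pp'] forward_neighbours(1)[OF Suc.prems, folded p'_def] by blast
  have inj: "neighbour p' e \<noteq> neighbour p' e'" if "e \<in> cont a" "e' \<in> cont a" "e \<noteq> e'" for e e'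
    using forward_neighbours(2)[OF Suc.prems, folded p'_def] that by (auto dest: inj_onD)
  have disj: "arc_sphere cover (p', neighbour p' e) (Suc r) \<inter> arc_sphere cover (p', neighbour p' e') (Suc r) = {}"
    if "e \<in> cont a" "e' \<in> cont a" "e \<noteq> e'" for e e'
    using neighbour(1)[OF p' cont] inj that by (intro arc_sphere_disjoint) auto
  have "(\<Sum>x\<in>arc_sphere cover (p, p') (Suc (Suc r)). h (\<pi> x)) =
      (\<Sum>e\<in>cont a. \<Sum>x\<in>arc_sphere cover (p', neighbour p' e) (Suc r). h (\<pi> x))"
    unfolding sphere using Suc.IH[OF p' cont] disj finite_cont by (intro sum.UNION_disjoint) auto
  also have "\<dots> = real q ^ r * (\<Sum>e\<in>cont a. (T ^^ r) (\<lambda>e. h (head G e)) e)"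
    using Suc.IH[OF p' cont] by (simp add: sum_distrib_left del: arc_sphere.simps)
  also have "(\<Sum>e\<in>cont a. (T ^^ r) (\<lambda>e. h (head G e)) e) = real q * (T ^^ Suc r) (\<lambda>e. h (head G e)) a"
    using Suc.prems by (simp add: sum_eq_card_average finite_cont card_cont nb_avg_def)
  finally show ?case
    using Suc.IH[OF p' cont] finite_cont unfolding sphere p'_def[symmetric]
    by (simp add: sphere del: arc_sphere.simps)
qed

lemma card_arc_sphere:
  assumes "p \<in> verts cover" "a \<in> out_arcs G (\<pi> p)"
  shows "card (arc_sphere cover (p, neighbour p a) (Suc r)) = q ^ r"
proof -
  have one: "(T ^^ r) (\<lambda>e. 1) b = 1" if "b \<in> arcs G" for b
    using that
  proof (induction r arbitrary: b)
    case (Suc r)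
    have "average ((T ^^ r) (\<lambda>e. 1)) (cont b) = 1"
      using Suc cont_subset by (intro average_const) (auto simp: finite_cont cont_nonempty)
    then show ?case unfolding funpow.simps comp_apply nb_avg_def[of G rv "(T ^^ r) (\<lambda>e. 1)"] .
  qed simp
  have "real (card (arc_sphere cover (p, neighbour p a) (Suc r))) = real q ^ r"
    using sum_arc_sphere[OF assms, of r "\<lambda>_. 1"] one assms(2) by (simp del: arc_sphere.simps)
  then show ?thesis
    by (metis of_nat_eq_iff of_nat_power)
qed

lemma average_arc_sphere:
  assumes l: "(p, p') \<in> arcs cover" "cover_proj_arc rv (p, p') = a"
  shows "average (lift_fun G base f) (arc_sphere cover (p, p') (Suc r)) = (T ^^ r) (\<lambda>e. f (head G e)) a"
    and "finite (arc_sphere cover (p, p') (Suc r))" and "arc_sphere cover (p, p') (Suc r) \<noteq> {}"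
proof -
  have p: "p \<in> verts cover" and a: "a \<in> out_arcs G (\<pi> p)" and p': "p' = neighbour p a"
    using arcs_cover_lift[OF l(1)] l(2) by auto
  show "finite (arc_sphere cover (p, p') (Suc r))"
    using sum_arc_sphere[OF p a] p' by blast
  have q: "0 < q ^ r"
    using q_ge_2 by simp
  then show "arc_sphere cover (p, p') (Suc r) \<noteq> {}"
    using card_arc_sphere[OF p a, of r] unfolding p' by (metis card.empty less_irrefl)
  show "average (lift_fun G base f) (arc_sphere cover (p, p') (Suc r)) = (T ^^ r) (\<lambda>e. f (head G e)) a"
    using sum_arc_sphere[OF p a, of r f] card_arc_sphere[OF p a, of r] q q_ge_2
    unfolding p' average_def lift_fun_def by (simp del: arc_sphere.simps)
qed

lemma finite_boundary:
  assumes "finite (verts X)" "subgraph X cover"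
  shows "finite (boundary X)"
proof (rule finite_subset)
  have "x \<in> verts cover" if "x \<in> verts X" for x
    using that assms(2) by (auto simp: subgraph_def)
  then show "boundary X \<subseteq> (SIGMA x:verts X. neighbour x ` out_arcs G (\<pi> x))"
    using neighbours_of by (fastforce simp: boundary_def)
  show "finite (SIGMA x:verts X. neighbour x ` out_arcs G (\<pi> x))"
    using assms(1) by (auto simp: finite_out_arcs)
qed

text \<open>
  A vertex of \<open>X\<close> of maximal length as a word can be extended without backtracking, as there is more
  than one arc to choose from, and the extension lies outside of \<open>X\<close>.
\<close>

lemma boundary_nonempty:
  assumes "finite (verts X)" "verts X \<noteq> {}" "subgraph X cover"
  shows "boundary X \<noteq> {}"
proof -
  obtain p where p: "p \<in> verts X" "\<And>p'. p' \<in> verts X \<Longrightarrow> length p' \<le> length p"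
  proof -
    have "Max (length ` verts X) \<in> length ` verts X"
      using assms by (intro Max_in) auto
    then obtain p where "p \<in> verts X" "length p = Max (length ` verts X)"
      by force
    then show ?thesis
      using that assms(1) by (metis Max_ge finite_imageI imageI)
  qed
  have pc: "p \<in> verts cover"
    using p(1) assms(3) by (auto simp: subgraph_def)
  have "card {rv (last p)} < card (out_arcs G (\<pi> p))"
    using q_ge_2 by (simp add: card_out_arcs cover_proj_in_verts pc)
  then have "\<not> out_arcs G (\<pi> p) \<subseteq> {rv (last p)}"
    by (meson card_mono finite.emptyI finite.insertI leD)
  then obtain e where e: "e \<in> out_arcs G (\<pi> p)" "e \<noteq> rv (last p)" by blast
  then have "(p, p @ [e]) \<in> arcs cover"
    using pc by (auto simp: arcs_cover_iff snoc_in_cover_iff)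
  moreover have "p @ [e] \<notin> verts X"
    using p(2)[of "p @ [e]"] by auto
  ultimately show ?thesis
    using p(1) by (auto simp: boundary_def)
qed

lemma vertex_tube_0:
  assumes sub: "subgraph X cover" and fin: "finite (verts X)" and ne: "verts X \<noteq> {}"
  shows "vertex_tube cover X 0 = verts X"
proof (intro set_eqI iffI)
  have sub: "verts X \<subseteq> verts cover"
    using sub by (simp add: subgraph_def)
  fix v
  {
    assume "v \<in> vertex_tube cover X 0"
    then have "v \<in> verts cover" "0 \<in> \<delta> v ` verts X"
      using Min_in[of "\<delta> v ` verts X"] fin ne by (auto simp: vertex_tube_def)
    then show "v \<in> verts X"
      using dist_eq_0_iff sub by auto
  next
    assume v: "v \<in> verts X"
    then have "0 \<in> \<delta> v ` verts X"
      using dist_eq_0_iff[of v v] sub by force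
    then have "Min (\<delta> v ` verts X) = 0"
      using fin by (intro Min_eqI) auto
    then show "v \<in> vertex_tube cover X 0"
      using v sub by (auto simp: vertex_tube_def)
  }
qed

lemma deviation_at_vertex:
  assumes "p \<in> verts cover" "1 \<le> C"
  shows "\<bar>lift_fun G base f p - average f (verts G)\<bar> \<le> C * L2_set f (verts G)"
proof -
  have "\<bar>f (\<pi> p) - average f (verts G)\<bar> \<le> L2_set f (verts G)"
    using abs_le_L2_set[OF finite_verts cover_proj_in_verts[OF assms(1)], of "\<lambda>x. f x - average f (verts G)"]
      L2_set_deviation_le[OF finite_verts, of f] by linarith
  also have "\<dots> \<le> C * L2_set f (verts G)"
    using mult_right_mono[OF assms(2) L2_set_nonneg[of f "verts G"]] by simp
  finally show ?thesis
    by (simp add: lift_fun_def)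
qed

lemma arc_mean_bound:
  assumes C: "1 \<le> C"
    and mix: "\<And>a r. a \<in> arcs G \<Longrightarrow>
      \<bar>(T ^^ r) (\<lambda>e. f (head G e)) a - average f (verts G)\<bar> \<le> C * L2_set f (verts G) * \<beta> ^ Suc r"
    and l: "l \<in> arcs cover"
  shows "\<bar>arc_mean G rv base r l f - average f (verts G)\<bar> \<le> C * L2_set f (verts G) * \<beta> ^ r"
proof -
  obtain p p' where [simp]: "l = (p, p')"
    by (cases l)
  show ?thesis
  proof (cases r)
    case 0
    have "p \<in> verts cover"
      using l by (simp add: arcs_cover_iff)
    then show ?thesis
      using deviation_at_vertex[OF _ C] 0 by (simp add: arc_mean_def average_def)
  next
    case (Suc n)
    have "cover_proj_arc rv (p, p') \<in> arcs G"
      using arcs_cover_lift[of p p'] l by simp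
    then show ?thesis
      using mix l by (simp add: arc_mean_def Suc average_arc_sphere(1) del: arc_sphere.simps)
  qed
qed

lemma tube_mean_bound:
  assumes C: "1 \<le> C"
    and mix: "\<And>a r. a \<in> arcs G \<Longrightarrow>
      \<bar>(T ^^ r) (\<lambda>e. f (head G e)) a - average f (verts G)\<bar> \<le> C * L2_set f (verts G) * \<beta> ^ Suc r"
    and sub: "subgraph X cover" and fin: "finite (verts X)" and conn: "Digraph_Component.connected X"
  shows "\<bar>tube_mean G rv base r X f - average f (verts G)\<bar> \<le> C * L2_set f (verts G) * \<beta> ^ r"
proof -
  have ne: "verts X \<noteq> {}"
    using conn by (auto simp: Digraph_Component.connected_def strongly_connected_def)
  show ?thesis
  proof (cases r)
    case 0
    have "x \<in> verts cover" if "x \<in> verts X" for x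
      using that sub by (auto simp: subgraph_def)
    then show ?thesis
      unfolding tube_mean_def 0 vertex_tube_0[OF sub fin ne]
      using deviation_at_vertex[OF _ C] fin ne by (intro average_near_const) auto
  next
    case (Suc n)
    have arcs: "l \<in> arcs cover" if "l \<in> boundary X" for l
      using that by (auto simp: boundary_def)
    show ?thesis
      unfolding tube_mean_def Suc vertex_tube_Suc[OF sub fin conn]
    proof (rule average_disjoint_Union_near_const[OF finite_boundary[OF fin sub] boundary_nonempty[OF fin ne sub]])
      fix l assume l: "l \<in> boundary X"
      show "finite (arc_sphere cover l (Suc n))" "arc_sphere cover l (Suc n) \<noteq> {}"
        using arcs[OF l] average_arc_sphere(2,3) by (metis surj_pair)+
      show "\<bar>average (lift_fun G base f) (arc_sphere cover l (Suc n)) - average f (verts G)\<bar>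
          \<le> C * L2_set f (verts G) * \<beta> ^ Suc n"
        using arc_mean_bound[OF C mix arcs[OF l], of "Suc n"] by (simp add: arc_mean_def del: arc_sphere.simps)
    qed (rule boundary_arc_spheres_disjoint[OF sub conn])
  qed
qed

end

theorem corollary4:
  fixes G :: "('a, 'b) pre_digraph" and rv :: "'b \<Rightarrow> 'b" and q :: nat
  assumes "fin_digraph G"
    and "bidirected_digraph G rv"
    and "Digraph_Component.connected G"
    and "\<not> bipartite G"
    and "q + 1 \<ge> 3"
    and "\<forall>v\<in>verts G. out_degree G v = q + 1"
  shows "\<exists>C>0. \<forall>f :: 'a \<Rightarrow> real. \<exists>\<beta>\<in>{real q powr (-1/2)..<1}. \<forall>base\<in>verts G.
    (\<forall>a\<in>arcs G. \<forall>l\<in>arc_lifts G rv base a. \<forall>r.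
       \<bar>arc_mean G rv base r l f - average f (verts G)\<bar> \<le> C * L2_set f (verts G) * \<beta> ^ r) \<and>
    (\<forall>X. subgraph X (universal_cover G rv base) \<and> graph X \<and> Digraph_Component.connected X \<longrightarrow>
       (\<forall>r. \<bar>tube_mean G rv base r X f - average f (verts G)\<bar> \<le> C * L2_set f (verts G) * \<beta> ^ r))"
proof -
  interpret fin_digraph G by (rule assms(1))
  interpret bidirected_digraph G rv by (rule assms(2))
  interpret regular_graph G rv q
    using assms(5,6) by unfold_locales auto
  obtain C \<beta> where C: "1 \<le> C" and \<beta>: "real q powr (-1/2) \<le> \<beta>" "\<beta> < 1"
    and mix: "\<And>f a r. a \<in> arcs G \<Longrightarrow>
       \<bar>(T ^^ r) (\<lambda>e. f (head G e)) a - average f (verts G)\<bar> \<le> C * L2_set f (verts G) * \<beta> ^ Suc r"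
    using exponential_mixing[OF assms(3,4)] by blast
  show ?thesis
  proof (intro exI[of _ C] conjI allI bexI[of _ \<beta>] ballI impI)
    fix f :: "'a \<Rightarrow> real" and base assume "base \<in> verts G"
    then interpret rooted_regular_graph G rv q base
      by unfold_locales
    show "\<bar>arc_mean G rv base r l f - average f (verts G)\<bar> \<le> C * L2_set f (verts G) * \<beta> ^ r"
      if "l \<in> arc_lifts G rv base a" for a l r
      using arc_mean_bound[OF C mix] that by (simp add: arc_lifts_def)
    show "\<bar>tube_mean G rv base r X f - average f (verts G)\<bar> \<le> C * L2_set f (verts G) * \<beta> ^ r"
      if X: "subgraph X cover \<and> graph X \<and> Digraph_Component.connected X" for X r
    proof -
      interpret X: graph X using X by simp
      show ?thesis
        using X by (intro tube_mean_bound[OF C mix]) auto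
    qed
  qed (use C \<beta> in auto)
qed

end
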